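(* For every integer $k \geq 1$, the graph $\overline{K_2 + C_{2k+1}}$ is a minimal non-UDG; that is, it is not a unit disk graph, but every proper induced subgraph of it is a unit disk graph.
   Context: All graphs are finite and simple. A graph $G=(V,E)$ is a unit disk graph (UDG) if there is a function $f:V\to\mathbb{R}^2$ such that for distinct $u,v\in V$, $uv\in E$ if and only if the Euclidean distance between $f(u)$ and $f(v)$ is at most $1$. $K_n$ is the complete graph on $n$ vertices, $C_n$ the chordless cycle on $n$ vertices, $G+H$ denotes the disjoint union of graphs $G$ and $H$, and $\overline{G}$ denotes the complement of $G$. *)

theory Defs
  imports "HOL-Analysis.Analysis"
begin

record 'a sgraph =
  verts :: "'a set"
  edges :: "'a set set"

definition simple_graph :: "'a sgraph \<Rightarrow> bool" where
  "simple_graph G \<longleftrightarrow>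
     finite (verts G) \<and> (\<forall>e \<in> edges G. e \<subseteq> verts G \<and> card e = 2)"

definition complete_graph :: "nat \<Rightarrow> nat sgraph" where
  "complete_graph n =
     \<lparr>verts = {..<n}, edges = {{u, v} | u v. u < n \<and> v < n \<and> u \<noteq> v}\<rparr>"

(* A cycle only for n >= 3. *)
definition cycle_graph :: "nat \<Rightarrow> nat sgraph" where
  "cycle_graph n = \<lparr>verts = {..<n}, edges = {{i, Suc i mod n} | i. i < n}\<rparr>"

definition disjoint_union :: "'a sgraph \<Rightarrow> 'b sgraph \<Rightarrow> ('a + 'b) sgraph" where
  "disjoint_union G H =
     \<lparr>verts = verts G <+> verts H,
      edges = image Inl ` edges G \<union> image Inr ` edges H\<rparr>"

definition complement_graph :: "'a sgraph \<Rightarrow> 'a sgraph" where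
  "complement_graph G =
     \<lparr>verts = verts G,
      edges = {{u, v} | u v. u \<in> verts G \<and> v \<in> verts G \<and> u \<noteq> v \<and> {u, v} \<notin> edges G}\<rparr>"

definition induced_subgraph :: "'a sgraph \<Rightarrow> 'a set \<Rightarrow> 'a sgraph" where
  "induced_subgraph G S = \<lparr>verts = S, edges = {e \<in> edges G. e \<subseteq> S}\<rparr>"

definition unit_disk_graph :: "'a sgraph \<Rightarrow> bool" where
  "unit_disk_graph G \<longleftrightarrow> simple_graph G \<and>
     (\<exists>f :: 'a \<Rightarrow> real ^ 2. \<forall>u \<in> verts G. \<forall>v \<in> verts G. u \<noteq> v \<longrightarrow>
        ({u, v} \<in> edges G \<longleftrightarrow> dist (f u) (f v) \<le> 1))"

(* The conjunct simple_graph G prevents a malformed G from counting as a non-unit-disk graph. *)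
definition minimal_non_udg :: "'a sgraph \<Rightarrow> bool" where
  "minimal_non_udg G \<longleftrightarrow> simple_graph G \<and> \<not> unit_disk_graph G \<and>
     (\<forall>S. S \<subset> verts G \<longrightarrow> unit_disk_graph (induced_subgraph G S))"

lemma simple_graph_complete_graph: "simple_graph (complete_graph n)"
  by (auto simp: simple_graph_def complete_graph_def card_2_iff)

lemma simple_graph_cycle_graph:
  assumes "n \<ge> 3"
  shows "simple_graph (cycle_graph n)"
proof -
  have "i \<noteq> Suc i mod n" if "i < n" for i
    using that assms by (cases "Suc i = n") auto
  then show ?thesis
    using assms by (auto simp: simple_graph_def cycle_graph_def card_2_iff)
qed

lemma simple_graph_disjoint_union:
  assumes "simple_graph G" "simple_graph H"
  shows "simple_graph (disjoint_union G H)"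
  using assms by (auto simp: simple_graph_def disjoint_union_def card_image)

lemma simple_graph_complement_graph:
  assumes "simple_graph G"
  shows "simple_graph (complement_graph G)"
  using assms by (auto simp: simple_graph_def complement_graph_def card_2_iff)

lemma simple_graph_induced_subgraph:
  assumes "simple_graph G" "S \<subseteq> verts G"
  shows "simple_graph (induced_subgraph G S)"
  using assms by (auto simp: simple_graph_def induced_subgraph_def intro: finite_subset)

end

theory Submission
  imports Defs
begin

text \<open>
  Let \<open>a\<close>, \<open>b\<close> be the vertices of \<open>K\<^sub>2\<close>. If \<open>c\<close>, \<open>d\<close> are within distance 1 of both \<open>a\<close> and \<open>b\<close>, and
  \<open>a\<close>, \<open>b\<close> are more than 1 apart, then \<open>c\<close>, \<open>d\<close> on the same side of the line \<open>ab\<close> are at most 1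
  apart. So in a unit disk representation consecutive vertices of the cycle lie on opposite sides
  of \<open>ab\<close>, which is impossible for an odd cycle.

  For minimality, enumerate the vertices of a regular \<open>N\<close>-gon (\<open>N\<close> odd) so that consecutive ones
  span a longest diagonal, and scale so that only the longest diagonals exceed 1. With \<open>N = 2k + 1\<close>
  this represents the complement of the cycle, and the centre represents a vertex adjacent to all.
  If a vertex of the cycle is deleted, the remaining path is represented by consecutive vertices
  with \<open>N\<close> much larger than \<open>k\<close>; they cluster around two antipodal points, which leaves room for
  \<open>a\<close> and \<open>b\<close>.
\<close>

lemma dist_real2: "dist p q = sqrt ((p $ 1 - q $ 1)\<^sup>2 + (p $ 2 - q $ 2)\<^sup>2)" for p q :: "real ^ 2"
  by (simp add: dist_vec_def L2_set_def sum_2 dist_real_def)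

lemma dist_real2_le_1_iff:
  "dist p q \<le> 1 \<longleftrightarrow> (p $ 1 - q $ 1)\<^sup>2 + (p $ 2 - q $ 2)\<^sup>2 \<le> 1" for p q :: "real ^ 2"
  by (simp add: dist_real2)

subsection \<open>Two points in a half lens\<close>

text \<open>With centres \<open>(s, 0)\<close> and \<open>(-s, 0)\<close>, the lens satisfies |x| <=
  1 - s < s. Hence moving the lower point \<open>(x, y)\<close> to the centre farther from
  \<open>(u, v)\<close> decreases neither coordinate difference, and that centre is within
  1.\<close>

lemma half_lens_diameter_aux:
  fixes s x y u v :: real
  assumes s: "s > 1/2"
    and x: "(x + s)\<^sup>2 + y\<^sup>2 \<le> 1" "(x - s)\<^sup>2 + y\<^sup>2 \<le> 1"
    and u: "(u + s)\<^sup>2 + v\<^sup>2 \<le> 1" "(u - s)\<^sup>2 + v\<^sup>2 \<le> 1"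
    and yv: "0 \<le> y" "y \<le> v"
  shows "(x - u)\<^sup>2 + (y - v)\<^sup>2 \<le> 1"
proof -
  have "(\<bar>x\<bar> + s)\<^sup>2 + y\<^sup>2 \<le> 1"
    using x by (cases "x \<ge> 0") (auto simp: power2_eq_square algebra_simps)
  then have "(\<bar>x\<bar> + s)\<^sup>2 \<le> 1"
    using zero_le_power2[of y] by linarith
  then have "\<bar>x\<bar> + s \<le> 1"
    unfolding abs_square_le_1 by linarith
  then have "\<bar>x - u\<bar> \<le> \<bar>u\<bar> + s"
    using s by linarith
  then have "(x - u)\<^sup>2 \<le> (\<bar>u\<bar> + s)\<^sup>2"
    using power_mono[of "\<bar>x - u\<bar>" _ 2] by simp
  moreover have "(\<bar>u\<bar> + s)\<^sup>2 + v\<^sup>2 \<le> 1"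
    using u by (cases "u \<ge> 0") (auto simp: power2_eq_square algebra_simps)
  moreover have "(v - y)\<^sup>2 \<le> v\<^sup>2"
    using yv by (intro power_mono) auto
  ultimately show ?thesis
    by (simp add: power2_commute[of y v])
qed

lemma half_lens_diameter:
  fixes s x y u v :: real
  assumes "s > 1/2"
    and "(x + s)\<^sup>2 + y\<^sup>2 \<le> 1" "(x - s)\<^sup>2 + y\<^sup>2 \<le> 1"
    and "(u + s)\<^sup>2 + v\<^sup>2 \<le> 1" "(u - s)\<^sup>2 + v\<^sup>2 \<le> 1"
    and "0 \<le> y" "0 \<le> v"
  shows "(x - u)\<^sup>2 + (y - v)\<^sup>2 \<le> 1"
proof (cases "y \<le> v")
  case True
  then show ?thesis using half_lens_diameter_aux assms by blast
next
  case False
  then have "(u - x)\<^sup>2 + (v - y)\<^sup>2 \<le> 1"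
    using half_lens_diameter_aux[of s u v x y] assms by linarith
  then show ?thesis by (simp add: power2_commute)
qed

text \<open>The cross product of \<open>b - a\<close> and \<open>p - a\<close>: its sign tells on
  which side of the line \<open>ab\<close> the point lies.\<close>

definition side :: "real ^ 2 \<Rightarrow> real ^ 2 \<Rightarrow> real ^ 2 \<Rightarrow> real" where
  "side a b p = (b $ 1 - a $ 1) * (p $ 2 - a $ 2) - (b $ 2 - a $ 2) * (p $ 1 - a $ 1)"

lemma side_swap: "side b a p = - side a b p"
  by (simp add: side_def algebra_simps)

lemma dist_le_1_same_side:
  assumes ab: "dist a b > 1"
    and c: "dist a c \<le> 1" "dist b c \<le> 1" and d: "dist a d \<le> 1" "dist b d \<le> 1"
    and sides: "0 \<le> side a b c" "0 \<le> side a b d"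
  shows "dist c d \<le> 1"
proof -
  define D where "D = dist a b"
  \<comment> \<open>\<open>X\<close> and \<open>Y\<close> are coordinates along and across
    \<open>ab\<close>, with the midpoint of \<open>ab\<close> as origin.\<close>
  define X where
    "X p = ((b $ 1 - a $ 1) * (p $ 1 - a $ 1) + (b $ 2 - a $ 2) * (p $ 2 - a $ 2)) / D - D / 2"
    for p :: "real ^ 2"
  define Y where "Y p = side a b p / D" for p :: "real ^ 2"
  have D: "D > 1" using ab by (simp add: D_def)
  have D2: "D\<^sup>2 = (b $ 1 - a $ 1)\<^sup>2 + (b $ 2 - a $ 2)\<^sup>2"
    by (simp add: D_def dist_real2 power2_commute)
  have isometry: "(X p - X q)\<^sup>2 + (Y p - Y q)\<^sup>2 = (p $ 1 - q $ 1)\<^sup>2 + (p $ 2 - q $ 2)\<^sup>2" for p q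
  proof -
    have "(X p - X q)\<^sup>2 + (Y p - Y q)\<^sup>2 =
        (((b $ 1 - a $ 1) * (p $ 1 - q $ 1) + (b $ 2 - a $ 2) * (p $ 2 - q $ 2))\<^sup>2 +
         ((b $ 1 - a $ 1) * (p $ 2 - q $ 2) - (b $ 2 - a $ 2) * (p $ 1 - q $ 1))\<^sup>2) / D\<^sup>2"
      by (simp add: X_def Y_def side_def power_divide flip: diff_divide_distrib add_divide_distrib)
         (simp add: algebra_simps)
    \<comment> \<open>The Brahmagupta-Fibonacci identity for a product of two sums of two
      squares.\<close>
    also have "\<dots> = D\<^sup>2 * ((p $ 1 - q $ 1)\<^sup>2 + (p $ 2 - q $ 2)\<^sup>2) / D\<^sup>2"
      unfolding D2 by (rule arg_cong[where f = "\<lambda>t. t / _"]) algebra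
    finally show ?thesis using D by simp
  qed
  have "X a = - (D / 2)" "Y a = 0"
    by (simp_all add: X_def Y_def side_def)
  moreover have "X b = D / 2"
    using D D2 by (simp add: X_def field_simps power2_eq_square)
  moreover have "Y b = 0"
    by (simp add: Y_def side_def)
  ultimately have "(X p + D / 2)\<^sup>2 + (Y p)\<^sup>2 = (a $ 1 - p $ 1)\<^sup>2 + (a $ 2 - p $ 2)\<^sup>2"
    and "(X p - D / 2)\<^sup>2 + (Y p)\<^sup>2 = (b $ 1 - p $ 1)\<^sup>2 + (b $ 2 - p $ 2)\<^sup>2" for p
    using isometry[of p a] isometry[of p b] by (auto simp: power2_commute)
  then have "(X c - X d)\<^sup>2 + (Y c - Y d)\<^sup>2 \<le> 1"
    using c d D sides by (intro half_lens_diameter[of "D / 2"]) (auto simp: dist_real2_le_1_iff Y_def)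
  then show ?thesis
    by (simp add: isometry dist_real2_le_1_iff)
qed

text \<open>Swapping \<open>a\<close> and \<open>b\<close> flips the sign of \<open>side\<close>,
  which covers the case of two negative sides.\<close>

lemma dist_gt_1_opposite_sides:
  assumes "dist a b > 1" "dist a c \<le> 1" "dist b c \<le> 1" "dist a d \<le> 1" "dist b d \<le> 1" "dist c d > 1"
  shows "0 \<le> side a b c \<longleftrightarrow> \<not> 0 \<le> side a b d"
  using dist_le_1_same_side[of a b c d] dist_le_1_same_side[of b a c d] assms
  unfolding side_swap[of b a] dist_commute[of b a] by linarith

subsection \<open>Vertices of a regular polygon in star order\<close>

text \<open>The sign makes each step turn by pi + pi/N. The radius gives chords of central angle pi
  - 2 pi/N length exactly 1, so those of angle pi - pi/N exceed 1.\<close>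

definition star_point :: "nat \<Rightarrow> nat \<Rightarrow> real ^ 2" where
  "star_point N i = (let r = 1 / (2 * cos (pi / N)) in
     vector [(-1) ^ i * r * sin (i * (pi / N)), (-1) ^ i * r * cos (i * (pi / N))])"

lemma star_point_nth:
  "star_point N i $ 1 = (-1) ^ i * sin (i * (pi / N)) / (2 * cos (pi / N))"
  "star_point N i $ 2 = (-1) ^ i * cos (i * (pi / N)) / (2 * cos (pi / N))"
  by (simp_all add: star_point_def Let_def)

lemma cos_pi_div_ge_half:
  assumes "N \<ge> 3"
  shows "cos (pi / real N) \<ge> 1 / 2"
proof -
  have "cos (pi / 3) \<le> cos (pi / real N)"
    using assms by (intro cos_monotone_0_pi_le) (auto intro: divide_left_mono simp: field_simps)
  then show ?thesis by (simp add: cos_60)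
qed

text \<open>The central angle has cosine \<open>(-1) ^ m * cos (m * (pi / N))\<close>; the law of
  cosines and the double angle formula do the rest.\<close>

lemma star_point_dist_le_1_iff:
  assumes "N \<ge> 3"
  shows "dist (star_point N i) (star_point N (i + m)) \<le> 1 \<longleftrightarrow>
    - ((-1) ^ m * cos (m * (pi / N))) \<le> cos (2 * (pi / N))"
proof -
  define c where "c = cos (pi / N)"
  define e :: real where "e = (-1) ^ i"
  define g :: real where "g = (-1) ^ m"
  define \<alpha> where "\<alpha> = i * (pi / N)"
  define \<beta> where "\<beta> = m * (pi / N)"
  have c: "c > 0" using cos_pi_div_ge_half[OF assms] by (simp add: c_def)
  have eg: "e\<^sup>2 = 1" "g\<^sup>2 = 1" by (simp_all add: e_def g_def flip: power_mult)
  have ang: "real (i + m) * (pi / N) = \<alpha> + \<beta>"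
    by (simp add: \<alpha>_def \<beta>_def algebra_simps add_divide_distrib)
  have "(e * sin \<alpha> - e * g * sin (\<alpha> + \<beta>))\<^sup>2 + (e * cos \<alpha> - e * g * cos (\<alpha> + \<beta>))\<^sup>2
      = e\<^sup>2 * ((sin \<alpha>)\<^sup>2 + (cos \<alpha>)\<^sup>2) + e\<^sup>2 * g\<^sup>2 * ((sin (\<alpha> + \<beta>))\<^sup>2 + (cos (\<alpha> + \<beta>))\<^sup>2)
        - 2 * e\<^sup>2 * g * (cos (\<alpha> + \<beta>) * cos \<alpha> + sin (\<alpha> + \<beta>) * sin \<alpha>)"
    by algebra
  also have "\<dots> = 2 - 2 * g * cos \<beta>"
    using cos_diff[of "\<alpha> + \<beta>" \<alpha>] by (simp add: eg)
  finally have chord: "(e * sin \<alpha> - e * g * sin (\<alpha> + \<beta>))\<^sup>2 + (e * cos \<alpha> - e * g * cos (\<alpha> + \<beta>))\<^sup>2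
    = 2 - 2 * g * cos \<beta>" .
  have "(star_point N i $ 1 - star_point N (i + m) $ 1)\<^sup>2 +
      (star_point N i $ 2 - star_point N (i + m) $ 2)\<^sup>2
    = ((e * sin \<alpha> - e * g * sin (\<alpha> + \<beta>))\<^sup>2 + (e * cos \<alpha> - e * g * cos (\<alpha> + \<beta>))\<^sup>2) / (2 * c)\<^sup>2"
    unfolding star_point_nth ang power_add e_def[symmetric] g_def[symmetric] c_def[symmetric]
      \<alpha>_def[symmetric]
    by (simp only: power_divide flip: diff_divide_distrib add_divide_distrib)
  then have "dist (star_point N i) (star_point N (i + m)) \<le> 1 \<longleftrightarrow> 2 - 2 * g * cos \<beta> \<le> 4 * c\<^sup>2"
    using c by (simp add: dist_real2_le_1_iff chord divide_le_eq power_mult_distrib)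
  also have "\<dots> \<longleftrightarrow> - (g * cos \<beta>) \<le> cos (2 * (pi / N))"
    by (simp only: cos_double_cos c_def) linarith
  finally show ?thesis by (simp add: g_def \<beta>_def)
qed

lemma cos_two_pi_div_less:
  assumes "N \<ge> 3"
  shows "cos (2 * (pi / real N)) < cos (pi / N)"
  using assms by (intro cos_monotone_0_pi) (auto simp: field_simps)

text \<open>For \<open>m\<close> from 2 to \<open>N - 2\<close>, the angle
  \<open>m * (pi / N)\<close> stays at least 2 pi/N away from 0 and pi, which bounds its cosine for
  either sign. This works for both parities of \<open>N\<close>.\<close>

lemma star_point_dist_short:
  assumes "N \<ge> 3" "0 < m" "m + 2 \<le> N"
  shows "dist (star_point N i) (star_point N (i + m)) \<le> 1 \<longleftrightarrow> m \<noteq> 1"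
proof (cases "m = 1")
  case True
  then show ?thesis
    using cos_two_pi_div_less[OF assms(1)] star_point_dist_le_1_iff[OF assms(1), of i 1]
    by (auto simp: not_le)
next
  case False
  with assms have m: "2 \<le> m" "real m \<le> real N - 2" by auto
  have pos: "0 < pi / N" using assms by simp
  have le: "2 * (pi / N) \<le> m * (pi / N)"
    using m(1) pos by (intro mult_right_mono) auto
  have "m * (pi / N) \<le> (N - 2) * (pi / N)"
    using m(2) pos by (intro mult_right_mono) auto
  also have "\<dots> = pi - 2 * (pi / N)"
    using assms by (simp add: of_nat_diff left_diff_distrib diff_divide_distrib)
  finally have ge: "m * (pi / N) \<le> pi - 2 * (pi / N)" .
  have "cos (m * (pi / N)) \<le> cos (2 * (pi / N))"
    using le ge pos by (intro cos_monotone_0_pi_le) linarith+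
  moreover have "cos (pi - 2 * (pi / N)) \<le> cos (m * (pi / N))"
    using le ge pos by (intro cos_monotone_0_pi_le) linarith+
  ultimately have "\<bar>cos (m * (pi / N))\<bar> \<le> cos (2 * (pi / N))"
    by (simp add: abs_le_iff)
  then have "- ((-1) ^ m * cos (m * (pi / N))) \<le> cos (2 * (pi / N))"
    by (cases "even m") auto
  then show ?thesis
    using False star_point_dist_le_1_iff[OF assms(1)] by simp
qed

text \<open>As \<open>N - 1\<close> is even, the central angle is pi - pi/N, just as for one step;
  this closes the cycle.\<close>

lemma star_point_dist_wrap:
  assumes "N \<ge> 3" "odd N"
  shows "dist (star_point N i) (star_point N (i + (N - 1))) > 1"
proof -
  have "real (N - 1) * (pi / N) = pi - pi / N"
    using assms by (simp add: of_nat_diff field_simps)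
  then have "cos (real (N - 1) * (pi / N)) = - cos (pi / N)"
    by (metis cos_pi_minus)
  then show ?thesis
    using assms cos_two_pi_div_less[OF assms(1)] star_point_dist_le_1_iff[OF assms(1), of i "N - 1"]
    by (auto simp: not_le)
qed

lemma norm_star_point_le_1:
  assumes "N \<ge> 3"
  shows "dist 0 (star_point N i) \<le> 1"
proof -
  define c where "c = cos (pi / N)"
  have c: "c \<ge> 1 / 2" using cos_pi_div_ge_half[OF assms] by (simp add: c_def)
  then have "1 \<le> (2 * c)\<^sup>2" by (intro one_le_power) auto
  moreover have "(star_point N i $ 1)\<^sup>2 + (star_point N i $ 2)\<^sup>2 = 1 / (2 * c)\<^sup>2"
    by (simp add: star_point_nth power_divide power_mult_distrib c_def flip: power_mult add_divide_distrib)
  ultimately show ?thesis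
    by (simp add: dist_real2_le_1_iff divide_le_eq del: dist_0_norm)
qed

text \<open>The factor 20 keeps the \<open>2 * k\<close> points within angle pi/10 of the vertical
  axis, so their horizontal offset is small.\<close>

lemma star_point_near_axis:
  assumes k: "k \<ge> 1" and i: "i < 2 * k" and s: "\<bar>s\<bar> = 3 / 5"
  shows "dist (vector [s, 0]) (star_point (20 * k) i) \<le> 1"
proof -
  let ?N = "20 * k"
  define c where "c = cos (pi / ?N)"
  have pi: "pi < 3.2" using pi_approx by simp
  have "pi / ?N \<le> pi / 20"
    using k by (intro divide_left_mono) auto
  then have \<phi>: "pi / ?N \<le> 0.16" "0 \<le> pi / ?N" using pi by auto
  \<comment> \<open>The bound 5/6 on the cosine is what gives radius at most 3/5 below.\<close>
  have "5 / 3 \<le> sqrt 3" by (intro real_le_rsqrt) (simp add: power2_eq_square)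
  then have "5 / 6 \<le> cos (pi / 6)" by (simp add: cos_30)
  also have "\<dots> \<le> c"
    unfolding c_def using \<phi> pi_gt3 by (intro cos_monotone_0_pi_le) auto
  finally have c: "c \<ge> 5 / 6" .
  have "real i * (pi / ?N) \<le> (2 * k) * (pi / ?N)"
    using i \<phi> by (intro mult_right_mono) auto
  also have "\<dots> = pi / 10" using k by simp
  finally have \<theta>: "real i * (pi / ?N) \<le> 0.32" "0 \<le> real i * (pi / ?N)"
    using pi \<phi> by auto
  define S where "S = (-1) ^ i * sin (real i * (pi / ?N))"
  define C where "C = (-1) ^ i * cos (real i * (pi / ?N))"
  have SC: "S\<^sup>2 + C\<^sup>2 = 1"
    by (simp add: S_def C_def power_mult_distrib flip: power_mult)
  have S: "\<bar>S\<bar> \<le> 0.32"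
    using abs_sin_x_le_abs_x[of "real i * (pi / ?N)"] \<theta>(1) unfolding abs_of_nonneg[OF \<theta>(2)]
    by (simp only: S_def abs_mult power_abs abs_minus_cancel abs_one power_one mult_1)
  define r where "r = 1 / (2 * c)"
  have r: "0 < r" "r \<le> 3 / 5" using c by (auto simp: r_def field_simps)
  have "\<bar>s * (r * S)\<bar> \<le> 3 / 5 * (3 / 5 * 0.32)"
    unfolding abs_mult s using r S by (intro mult_mono) auto
  moreover have "r\<^sup>2 \<le> (3 / 5)\<^sup>2" using r by (intro power_mono) auto
  moreover have "s\<^sup>2 = (3 / 5)\<^sup>2" using s by (metis power2_abs)
  \<comment> \<open>The three terms are at most 0.36, 0.2304 and 0.36, with sum 0.9504.\<close>
  moreover have "(s - r * S)\<^sup>2 + (0 - r * C)\<^sup>2 = s\<^sup>2 - 2 * (s * (r * S)) + r\<^sup>2 * (S\<^sup>2 + C\<^sup>2)"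
    by algebra
  ultimately have "(s - r * S)\<^sup>2 + (0 - r * C)\<^sup>2 \<le> 1"
    unfolding SC by (simp add: power2_eq_square)
  then show ?thesis
    by (simp add: dist_real2_le_1_iff star_point_nth r_def S_def C_def c_def)
qed

subsection \<open>The complement of an edge and a disjoint cycle\<close>

abbreviation co_K2_cycle :: "nat \<Rightarrow> (nat + nat) sgraph" where
  "co_K2_cycle n \<equiv> complement_graph (disjoint_union (complete_graph 2) (cycle_graph n))"

definition cycle_adj :: "nat \<Rightarrow> nat \<Rightarrow> nat \<Rightarrow> bool" where
  "cycle_adj n i j \<longleftrightarrow> j = Suc i mod n \<or> i = Suc j mod n"

lemma verts_co_K2_cycle: "verts (co_K2_cycle n) = {..<2} <+> {..<n}"
  by (simp add: complement_graph_def disjoint_union_def complete_graph_def cycle_graph_def)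

lemma Inl_image_eq_iff: "{Inl i, Inl j} = Inl ` e \<longleftrightarrow> e = {i, j}"
  using inj_image_eq_iff[OF inj_Inl, of "{i, j}" e] by auto

lemma Inr_image_eq_iff: "{Inr i, Inr j} = Inr ` e \<longleftrightarrow> e = {i, j}"
  using inj_image_eq_iff[OF inj_Inr, of "{i, j}" e] by auto

lemma edges_complement_graph_iff:
  "{u, v} \<in> edges (complement_graph G) \<longleftrightarrow>
    u \<in> verts G \<and> v \<in> verts G \<and> u \<noteq> v \<and> {u, v} \<notin> edges G"
  unfolding complement_graph_def by (auto simp: doubleton_eq_iff insert_commute)

lemma co_K2_cycle_edges:
  "i < 2 \<Longrightarrow> j < 2 \<Longrightarrow> {Inl i, Inl j} \<notin> edges (co_K2_cycle n)"
  "i < 2 \<Longrightarrow> j < n \<Longrightarrow> {Inl i, Inr j} \<in> edges (co_K2_cycle n)"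
  "i < n \<Longrightarrow> j < 2 \<Longrightarrow> {Inr i, Inl j} \<in> edges (co_K2_cycle n)"
  "i < n \<Longrightarrow> j < n \<Longrightarrow> i \<noteq> j \<Longrightarrow> {Inr i, Inr j} \<in> edges (co_K2_cycle n) \<longleftrightarrow> \<not> cycle_adj n i j"
  unfolding edges_complement_graph_iff
  by (auto simp: disjoint_union_def complete_graph_def cycle_graph_def cycle_adj_def
      image_iff Inl_image_eq_iff Inr_image_eq_iff doubleton_eq_iff)

lemma simple_graph_co_K2_cycle:
  "n \<ge> 3 \<Longrightarrow> simple_graph (co_K2_cycle n)"
  by (intro simple_graph_complement_graph simple_graph_disjoint_union
      simple_graph_complete_graph simple_graph_cycle_graph)

section \<open>Odd cycles admit no representation\<close>

lemma not_unit_disk_graph_co_K2_odd_cycle: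
  assumes "n \<ge> 3" "odd n"
  shows "\<not> unit_disk_graph (co_K2_cycle n)"
proof
  assume "unit_disk_graph (co_K2_cycle n)"
  then obtain f :: "nat + nat \<Rightarrow> real ^ 2" where
    f: "\<And>u v. u \<in> {..<2} <+> {..<n} \<Longrightarrow> v \<in> {..<2} <+> {..<n} \<Longrightarrow> u \<noteq> v \<Longrightarrow>
      {u, v} \<in> edges (co_K2_cycle n) \<longleftrightarrow> dist (f u) (f v) \<le> 1"
    unfolding unit_disk_graph_def verts_co_K2_cycle by blast
  define up where "up i \<longleftrightarrow> 0 \<le> side (f (Inl 0)) (f (Inl 1)) (f (Inr i))" for i
  have ab: "dist (f (Inl 0)) (f (Inl 1)) > 1"
    using f[of "Inl 0" "Inl 1"] co_K2_cycle_edges(1)[of 0 1 n] by (simp add: InlI not_le)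
  have ac: "dist (f (Inl i)) (f (Inr j)) \<le> 1" if "i < 2" "j < n" for i j
    using f[of "Inl i" "Inr j"] co_K2_cycle_edges(2) that by auto
  have cd: "dist (f (Inr i)) (f (Inr j)) > 1" if "i < n" "j < n" "i \<noteq> j" "cycle_adj n i j" for i j
    using f[of "Inr i" "Inr j"] co_K2_cycle_edges(4) that by (simp add: InrI not_le)
  have alternate: "up i \<longleftrightarrow> \<not> up j" if "i < n" "j < n" "i \<noteq> j" "cycle_adj n i j" for i j
    unfolding up_def using ab ac cd that by (intro dist_gt_1_opposite_sides) auto
  have parity: "i < n \<Longrightarrow> up i \<longleftrightarrow> (even i \<longleftrightarrow> up 0)" for i
  proof (induction i)
    case (Suc i)
    then show ?case using alternate[of i "Suc i"] by (auto simp: cycle_adj_def)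
  qed simp
  \<comment> \<open>The closing edge joins 0 to \<open>n - 1\<close>, which is even, so
    \<open>parity\<close> puts both on the same side.\<close>
  have "up (n - 1) \<longleftrightarrow> \<not> up 0"
    using assms by (intro alternate) (auto simp: cycle_adj_def)
  then show False
    using parity[of "n - 1"] assms by auto
qed

section \<open>Representing the graph with one vertex deleted\<close>

lemma unit_disk_graph_induced_subgraphI:
  fixes f :: "'a \<Rightarrow> real ^ 2"
  assumes "simple_graph G" "S \<subseteq> verts G - {w}"
    and "\<And>u v. u \<in> verts G \<Longrightarrow> v \<in> verts G \<Longrightarrow> u \<noteq> w \<Longrightarrow> v \<noteq> w \<Longrightarrow> u \<noteq> v \<Longrightarrow>
      {u, v} \<in> edges G \<longleftrightarrow> dist (f u) (f v) \<le> 1"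
  shows "unit_disk_graph (induced_subgraph G S)"
  unfolding unit_disk_graph_def
proof (intro conjI exI[of _ f] ballI impI)
  show "simple_graph (induced_subgraph G S)"
    using assms(1,2) by (intro simple_graph_induced_subgraph) auto
qed (use assms in \<open>auto simp: induced_subgraph_def\<close>)

lemma star_point_cycle_adj_iff:
  assumes "n \<ge> 3" "odd n" "i < n" "j < n" "i \<noteq> j"
  shows "dist (star_point n i) (star_point n j) \<le> 1 \<longleftrightarrow> \<not> cycle_adj n i j"
  using assms(3-5)
\<comment> \<open>By symmetry \<open>i < j\<close>; cycle edges are then the differences 1 and
  \<open>n - 1\<close>.\<close>
proof (induction i j rule: linorder_wlog)
  case (le i j)
  define m where "m = j - i"
  have m: "j = i + m" "0 < m" "m < n" using le by (auto simp: m_def)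
  have "cycle_adj n i j \<longleftrightarrow> m = 1 \<or> m = n - 1"
    using m le by (cases "Suc j = n") (auto simp: cycle_adj_def)
  then show ?case
    using star_point_dist_short[of n m i] star_point_dist_wrap[of n i] m assms(1,2)
    by (cases "m = n - 1") (auto simp: not_le)
next
  case (sym i j)
  then show ?case by (auto simp: dist_commute cycle_adj_def)
qed

text \<open>The position of vertex \<open>i \<noteq> w\<close> on the path left after deleting \<open>w\<close> from the \<open>n\<close>-cycle.\<close>

definition path_pos :: "nat \<Rightarrow> nat \<Rightarrow> nat \<Rightarrow> nat" where
  "path_pos n w i = (if i > w then i - w - 1 else i + n - w - 1)"

text \<open>Positions run from 0 to \<open>n - 2\<close>, so differences are at most
  \<open>N - 2\<close> and only \<open>star_point_dist_short\<close> is needed.\<close>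

lemma star_point_path_adj_iff:
  assumes N: "N \<ge> n" "n \<ge> 3"
    and "i < n" "j < n" "w < n" "i \<noteq> j" "i \<noteq> w" "j \<noteq> w"
  shows "dist (star_point N (path_pos n w i)) (star_point N (path_pos n w j)) \<le> 1 \<longleftrightarrow>
    \<not> cycle_adj n i j"
proof -
  \<comment> \<open>With \<open>w\<close> removed, the cyclic successor is the next position, also
    across the step from \<open>n - 1\<close> to 0.\<close>
  have succ: "j = Suc i mod n \<longleftrightarrow> path_pos n w j = path_pos n w i + 1"
    if "i < n" "j < n" "i \<noteq> w" "j \<noteq> w" for i j
  proof (cases "Suc i = n")
    case True
    then show ?thesis using that \<open>w < n\<close> by (simp add: path_pos_def) linarith
  next
    case False
    then have "Suc i mod n = Suc i" using that by simp
    then show ?thesis using that False \<open>w < n\<close> by (simp add: path_pos_def) linarith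
  qed
  have "path_pos n w i + 2 \<le> n" if "i < n" "i \<noteq> w" for i
    using that \<open>w < n\<close> by (cases "i > w") (auto simp: path_pos_def)
  then have "path_pos n w i + 2 \<le> n" "path_pos n w j + 2 \<le> n"
    using assms by blast+
  moreover have "path_pos n w i \<noteq> path_pos n w j"
    using assms(3-8) by (cases "i > w"; cases "j > w") (auto simp: path_pos_def)
  ultimately show ?thesis
    using succ[of i j] succ[of j i] assms
      star_point_dist_short[of N "path_pos n w j - path_pos n w i" "path_pos n w i"]
      star_point_dist_short[of N "path_pos n w i - path_pos n w j" "path_pos n w j"]
    unfolding cycle_adj_def
    by (cases "path_pos n w i \<le> path_pos n w j") (simp_all add: dist_commute, linarith+)
qed

lemma unit_disk_graph_delete_K2_vertex:
  assumes n: "n \<ge> 3" "odd n" and S: "S \<subseteq> verts (co_K2_cycle n) - {Inl w}" and w: "w < 2"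
  shows "unit_disk_graph (induced_subgraph (co_K2_cycle n) S)"
proof (rule unit_disk_graph_induced_subgraphI[OF simple_graph_co_K2_cycle[OF n(1)] S])
  fix u v
  assume "u \<in> verts (co_K2_cycle n)" "v \<in> verts (co_K2_cycle n)" "u \<noteq> Inl w" "v \<noteq> Inl w" "u \<noteq> v"
  then show "{u, v} \<in> edges (co_K2_cycle n) \<longleftrightarrow>
      dist (case_sum (\<lambda>_. 0) (star_point n) u) (case_sum (\<lambda>_. 0) (star_point n) v) \<le> 1"
    using w star_point_cycle_adj_iff[OF n] norm_star_point_le_1[OF n(1)] co_K2_cycle_edges(2-4)
    by (auto simp: verts_co_K2_cycle dist_commute less_2_cases_iff)
qed

lemma unit_disk_graph_delete_cycle_vertex:
  assumes k: "k \<ge> 1" and n: "n = 2 * k + 1"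
    and S: "S \<subseteq> verts (co_K2_cycle n) - {Inr w}" and w: "w < n"
  shows "unit_disk_graph (induced_subgraph (co_K2_cycle n) S)"
proof -
  \<comment> \<open>The two vertices of the edge are 6/5 apart on the horizontal axis, between the
    two clusters of path vertices.\<close>
  define f :: "nat + nat \<Rightarrow> real ^ 2" where
    "f = case_sum (\<lambda>i. vector [if i = 0 then 3 / 5 else - 3 / 5, 0])
      (\<lambda>i. star_point (20 * k) (path_pos n w i))"
  have n3: "n \<ge> 3" using k n by simp
  have path: "path_pos n w i < 2 * k" if "i < n" "i \<noteq> w" for i
    using that n w by (auto simp: path_pos_def)
  have ab: "\<not> dist (f (Inl i)) (f (Inl j)) \<le> 1" if "i < 2" "j < 2" "i \<noteq> j" for i j
    using that by (auto simp: f_def dist_real2_le_1_iff less_2_cases_iff power2_eq_square)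
  have ac: "dist (f (Inl i)) (f (Inr j)) \<le> 1" if "j < n" "j \<noteq> w" for i j
    using path[OF that] k by (auto simp: f_def intro!: star_point_near_axis)
  have cd: "dist (f (Inr i)) (f (Inr j)) \<le> 1 \<longleftrightarrow> \<not> cycle_adj n i j"
    if "i < n" "j < n" "i \<noteq> j" "i \<noteq> w" "j \<noteq> w" for i j
    using star_point_path_adj_iff[of n "20 * k" i j w] that w k n by (simp add: f_def)
  show ?thesis
  proof (rule unit_disk_graph_induced_subgraphI[OF simple_graph_co_K2_cycle[OF n3] S])
    fix u v
    assume "u \<in> verts (co_K2_cycle n)" "v \<in> verts (co_K2_cycle n)" "u \<noteq> Inr w" "v \<noteq> Inr w" "u \<noteq> v"
    then show "{u, v} \<in> edges (co_K2_cycle n) \<longleftrightarrow> dist (f u) (f v) \<le> 1"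
      using ab ac cd co_K2_cycle_edges
      by (auto simp: verts_co_K2_cycle dist_commute[of "f (Inr _)" "f (Inl _)"])
  qed
qed

theorem theorem6:
  fixes k :: nat
  assumes "k \<ge> 1"
  shows "minimal_non_udg
    (complement_graph (disjoint_union (complete_graph 2) (cycle_graph (2 * k + 1))))"
proof -
  let ?n = "2 * k + 1"
  have n: "?n \<ge> 3" "odd ?n" using assms by auto
  have "unit_disk_graph (induced_subgraph (co_K2_cycle ?n) S)" if S: "S \<subset> verts (co_K2_cycle ?n)" for S
  proof -
    \<comment> \<open>A proper subset misses some vertex \<open>w\<close>, and a representation of
      all other vertices restricts to it.\<close>
    obtain w where w: "w \<in> {..<2} <+> {..<?n}" "S \<subseteq> verts (co_K2_cycle ?n) - {w}"
      using S unfolding verts_co_K2_cycle by blast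
    then show ?thesis
      using unit_disk_graph_delete_K2_vertex[OF n] unit_disk_graph_delete_cycle_vertex[OF assms refl]
      by blast
  qed
  then show ?thesis
    unfolding minimal_non_udg_def
    using simple_graph_co_K2_cycle[OF n(1)] not_unit_disk_graph_co_K2_odd_cycle[OF n] by blast
qed

end
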